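(* Let $X_1,X_2,\dots$ be i.i.d. from $P^*\in\mathcal P_{\theta^*}$, let $\{M_n^\theta:\theta\in\Theta,\ n\ge 1\}$ be a family such that, for each $\theta\in\Theta$ and $n\ge1$, $M_n^\theta$ is a statistic of $X_1,\dots,X_n$ that is an e-value under $\theta$, and for each $n$ let $\tilde\theta_n^{(E)}\in\arg\min_{\theta\in\Theta}M_n^\theta$ be an ME-estimator. Let $(\alpha_n)$ be a sequence of numbers in $(0,1)$ such that $\sum_{n=1}^\infty\alpha_n<\infty$, and define $$\mathrm{CI}_n^*=\{\theta\in\Theta: M_n^\theta\le 1/\alpha_n\}.$$ Then the sequence $(\mathrm{CI}_n^* )$ is almost sure for $\theta^*$, i.e. $$P^*(\theta^*\in \mathrm{CI}_n^* \text{ for all but finitely many } n)=1,$$ and it also contains the ME-estimators for all but finitely many $n$ almost surely: $$P^*(\tilde\theta_n^{(E)}\in \mathrm{CI}_n^* \text{ for all but finitely many } n)=1.$$ Consequently, for any sequence $(r_n)$ of positive numbers, $$P^*\big(|\tilde\theta_n^{(E)}-\theta^*|=\mathcal O(r_n)\,\big|\,\operatorname{diam}(\mathrm{CI}_n^* )=\mathcal O(r_n)\big)=1,$$ $$P^*\big(|\tilde\theta_n^{(E)}-\theta^*|=o(r_n)\,\big|\,\operatorname{diam}(\mathrm{CI}_n^* )=o(r_n)\big)=1.$$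
   Context: $\Theta$ is a parameter space, with the distance between $\theta,\theta'$ written $|\theta-\theta'|$; $\operatorname{diam}(I)=\sup_{\theta,\theta'\in I}|\theta-\theta'|$. For each $\theta\in\Theta$, $\mathcal P_\theta$ is a set of data-generating distributions; $\mathbb E_\theta$ in a statement means that the statement holds under i.i.d. data from every $P\in\mathcal P_\theta$. The observed data are i.i.d. from an unknown $P^*\in\mathcal P_{\theta^*}$, $\theta^*\in\Theta$; $P^*(\cdot)$ also denotes probability under this i.i.d. law. A statistic $M_n^\theta$ is an e-value under $\theta$ if $M_n^\theta\ge0$ and $\mathbb E_\theta M_n^\theta\le1$. An ME-estimator is any element of $\arg\min_{\theta\in\Theta}M_n^\theta$, which is assumed nonempty (ties broken arbitrarily). A sequence of random sets $(I_n)_{n\ge1}$ is a sequence of almost sure confidence sets for a non-random element $x$ (is "almost sure for $x$") if with probability 1 there exists $N>1$ with $x\in\bigcap_{n=N}^\infty I_n$. All events in question are assumed measurable. $P^*(A\mid B)=1$ is understood as $P^*(B\cap A^c)=0$ (vacuous if $P^*(B)=0$). *)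

theory Defs
  imports "HOL-Probability.Probability" "HOL-Library.Landau_Symbols"
begin

(* Sequences are indexed by n \<ge> 1; values at index 0 are never constrained and never matter.
   S is the measurable space in which a single observation takes its values. *)

definition iid_from :: "'w measure \<Rightarrow> 'a measure \<Rightarrow> (nat \<Rightarrow> 'w \<Rightarrow> 'a) \<Rightarrow> 'a measure \<Rightarrow> bool" where
  "iid_from \<Omega> S X P \<longleftrightarrow>
     prob_space \<Omega> \<and>
     prob_space.indep_vars \<Omega> (\<lambda>_. S) X {1..} \<and>
     (\<forall>i\<ge>1. distr \<Omega> S (X i) = P)"

definition sample :: "(nat \<Rightarrow> 'w \<Rightarrow> 'a) \<Rightarrow> nat \<Rightarrow> 'w \<Rightarrow> (nat \<Rightarrow> 'a)" where
  "sample X n \<omega> = (\<lambda>i\<in>{1..n}. X i \<omega>)"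

(* An e-value of n observations for a set Ps of distributions: a measurable function T of
   (x_1, ..., x_n) whose mean under n i.i.d. draws from P is at most 1, for every P in Ps.
   Nonnegativity is built into ennreal; the value \<infinity> is allowed. *)
definition e_value ::
  "'a measure \<Rightarrow> 'a measure set \<Rightarrow> nat \<Rightarrow> ((nat \<Rightarrow> 'a) \<Rightarrow> ennreal) \<Rightarrow> bool" where
  "e_value S Ps n T \<longleftrightarrow>
     T \<in> borel_measurable (Pi\<^sub>M {1..n} (\<lambda>_. S)) \<and>
     (\<forall>P\<in>Ps. (\<integral>\<^sup>+x. T x \<partial>Pi\<^sub>M {1..n} (\<lambda>_. P)) \<le> 1)"

definition CI ::
  "'p set \<Rightarrow> (nat \<Rightarrow> 'p \<Rightarrow> (nat \<Rightarrow> 'a) \<Rightarrow> ennreal) \<Rightarrow> (nat \<Rightarrow> 'w \<Rightarrow> 'a) \<Rightarrow> (nat \<Rightarrow> real) \<Rightarrow>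
   nat \<Rightarrow> 'w \<Rightarrow> 'p set" where
  "CI \<Theta> M X \<alpha> n \<omega> = {\<theta>\<in>\<Theta>. M n \<theta> (sample X n \<omega>) \<le> ennreal (1 / \<alpha> n)}"

definition almost_sure_for :: "'w measure \<Rightarrow> (nat \<Rightarrow> 'w \<Rightarrow> 'p set) \<Rightarrow> 'p \<Rightarrow> bool" where
  "almost_sure_for \<Omega> I x \<longleftrightarrow> (AE \<omega> in \<Omega>. \<exists>N>1. x \<in> (\<Inter>n\<in>{N..}. I n \<omega>))"

(* The real-valued library constant diameter is not the supremum on unbounded sets;
   here an unbounded set has diameter \<infinity>. *)
definition diam :: "'p::metric_space set \<Rightarrow> ennreal" where
  "diam I = (SUP \<theta>\<in>I. SUP \<theta>'\<in>I. ennreal (dist \<theta> \<theta>'))"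

(* f = O(r) and f = o(r) for [0,\<infinity>]-valued f: finitely many values of f may be infinite. *)
definition ennreal_bigo :: "(nat \<Rightarrow> ennreal) \<Rightarrow> (nat \<Rightarrow> real) \<Rightarrow> bool" where
  "ennreal_bigo f r \<longleftrightarrow>
     (\<forall>\<^sub>F n in sequentially. f n < \<infinity>) \<and> (\<lambda>n. enn2real (f n)) \<in> O(r)"

definition ennreal_smallo :: "(nat \<Rightarrow> ennreal) \<Rightarrow> (nat \<Rightarrow> real) \<Rightarrow> bool" where
  "ennreal_smallo f r \<longleftrightarrow>
     (\<forall>\<^sub>F n in sequentially. f n < \<infinity>) \<and> (\<lambda>n. enn2real (f n)) \<in> o(r)"

end

theory Submission
  imports Defs
begin

text \<open>Only the e-value at the true parameter needs control. Its mean under the data is at most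
  1, so Markov's inequality bounds the probability that it exceeds 1/\<alpha>_n by \<alpha>_n. These
  bounds are summable, and Borel-Cantelli leaves only finitely many exceedances almost surely; this
  is \<open>AE_eventually_le_inverse_of_nn_integral_le_one\<close>, and
  \<open>e_value_sample\<close> supplies its moment bound. A minimizer has an e-value no larger than
  that of \<open>\<theta>star\<close>, so it lies in the set whenever \<open>\<theta>star\<close>
  does. From then on the distance between the two is at most the diameter of the set
  (\<open>dist_le_diam\<close>), and the rates follow.\<close>

lemma (in prob_space) AE_eventually_le_inverse_of_nn_integral_le_one:
  fixes Y :: "nat \<Rightarrow> 'a \<Rightarrow> ennreal"
  assumes Y [measurable]: "\<And>n. Y n \<in> borel_measurable M"
    and mean: "\<And>n. (\<integral>\<^sup>+\<omega>. Y n \<omega> \<partial>M) \<le> 1"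
    and pos: "\<And>n. 0 < \<alpha> n"
    and sum: "summable \<alpha>"
  shows "AE \<omega> in M. \<forall>\<^sub>F n in sequentially. Y n \<omega> \<le> ennreal (1 / \<alpha> n)"
proof -
  define A where "A n = {\<omega> \<in> space M. ennreal (1 / \<alpha> n) < Y n \<omega>}" for n
  have A_meas: "A n \<in> sets M" for n
    unfolding A_def by measurable
  have A_le: "measure M (A n) \<le> \<alpha> n" for n
  proof -
    \<comment> \<open>The threshold is rescaled to 1, the form in which
      \<open>nn_integral_Markov_inequality\<close> states its event; its factor
      \<open>\<alpha> n\<close> then becomes the bound on the probability.\<close>
    have *: "1 \<le> ennreal (\<alpha> n) * Y n \<omega>" if "\<omega> \<in> A n" for \<omega>
    proof -
      have "ennreal (\<alpha> n) * ennreal (1 / \<alpha> n) \<le> ennreal (\<alpha> n) * Y n \<omega>"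
        using that by (intro mult_left_mono) (auto simp: A_def)
      then show ?thesis
        using pos[of n] by (simp add: ennreal_mult'[symmetric])
    qed
    have "emeasure M (A n) \<le> emeasure M ({\<omega> \<in> space M. 1 \<le> ennreal (\<alpha> n) * Y n \<omega>})"
      using * by (intro emeasure_mono) (auto simp: A_def)
    also have "\<dots> \<le> ennreal (\<alpha> n) * (\<integral>\<^sup>+\<omega>. Y n \<omega> * indicator (space M) \<omega> \<partial>M)"
      using nn_integral_Markov_inequality[of "Y n" "space M" M "ennreal (\<alpha> n)"] by simp
    also have "\<dots> = ennreal (\<alpha> n) * (\<integral>\<^sup>+\<omega>. Y n \<omega> \<partial>M)"
      by (simp cong: nn_integral_cong)
    also have "\<dots> \<le> ennreal (\<alpha> n)"
      using mult_left_mono[OF mean, of "ennreal (\<alpha> n)" n] by simp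
    finally show ?thesis
      using pos[of n] by (simp add: emeasure_eq_measure)
  qed
  have "AE \<omega> in M. \<forall>\<^sub>F n in sequentially. \<omega> \<in> space M - A n"
  proof (rule borel_cantelli_AE1)
    show "summable (\<lambda>n. measure M (A n))"
      by (rule summable_comparison_test'[OF sum]) (simp add: A_le)
  qed (use A_meas in \<open>auto simp: emeasure_eq_measure\<close>)
  then show ?thesis
    by eventually_elim (auto simp: A_def elim: eventually_mono)
qed

text \<open>Independence passes from the whole index set to the finite block, where it says that the
  joint law is the product of the marginals. With \<open>n \<ge> 1\<close> the block is nonempty, as
  the library characterization requires.\<close>

lemma iid_from_distr_sample:
  assumes iid: "iid_from \<Omega> S X P" and n: "n \<ge> 1"
  shows "sample X n \<in> measurable \<Omega> (Pi\<^sub>M {1..n} (\<lambda>_. S))"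
    and "distr \<Omega> (Pi\<^sub>M {1..n} (\<lambda>_. S)) (sample X n) = Pi\<^sub>M {1..n} (\<lambda>_. P)"
proof -
  interpret prob_space \<Omega>
    using iid by (simp add: iid_from_def)
  have ind: "indep_vars (\<lambda>_. S) X {1..n}"
    using iid by (auto simp: iid_from_def intro: indep_vars_subset)
  then have X: "random_variable S (X i)" if "i \<in> {1..n}" for i
    using that by (auto simp: indep_vars_def)
  have sample_eq: "sample X n = (\<lambda>\<omega>. \<lambda>i\<in>{1..n}. X i \<omega>)"
    by (simp add: sample_def fun_eq_iff)
  show "sample X n \<in> measurable \<Omega> (Pi\<^sub>M {1..n} (\<lambda>_. S))"
    unfolding sample_eq using X by (rule measurable_restrict)
  have "distr \<Omega> (Pi\<^sub>M {1..n} (\<lambda>_. S)) (sample X n) = Pi\<^sub>M {1..n} (\<lambda>i. distr \<Omega> S (X i))"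
    unfolding sample_eq using indep_vars_iff_distr_eq_PiM'[where I = "{1..n}" and X = X and M' = "\<lambda>_. S"]
     X ind n by auto
  also have "\<dots> = Pi\<^sub>M {1..n} (\<lambda>_. P)"
    using iid by (intro PiM_cong) (auto simp: iid_from_def)
  finally show "distr \<Omega> (Pi\<^sub>M {1..n} (\<lambda>_. S)) (sample X n) = Pi\<^sub>M {1..n} (\<lambda>_. P)" .
qed

text \<open>Change of variables: \<open>e_value\<close> speaks of integrals over a product measure,
  which is the law of the sample.\<close>

lemma e_value_sample:
  assumes iid: "iid_from \<Omega> S X P" and n: "n \<ge> 1" and P: "P \<in> Ps" and T: "e_value S Ps n T"
  shows "(\<lambda>\<omega>. T (sample X n \<omega>)) \<in> borel_measurable \<Omega>"
    and "(\<integral>\<^sup>+\<omega>. T (sample X n \<omega>) \<partial>\<Omega>) \<le> 1"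
proof -
  have T_meas: "T \<in> borel_measurable (Pi\<^sub>M {1..n} (\<lambda>_. S))"
    using T by (simp add: e_value_def)
  note [measurable] = iid_from_distr_sample(1)[OF iid n] T_meas
  show "(\<lambda>\<omega>. T (sample X n \<omega>)) \<in> borel_measurable \<Omega>"
    by measurable
  have "(\<integral>\<^sup>+\<omega>. T (sample X n \<omega>) \<partial>\<Omega>) = (\<integral>\<^sup>+x. T x \<partial>Pi\<^sub>M {1..n} (\<lambda>_. P))"
    unfolding iid_from_distr_sample(2)[OF iid n, symmetric]
    by (rule nn_integral_distr[symmetric]) measurable
  also have "\<dots> \<le> 1"
    using T P by (simp add: e_value_def)
  finally show "(\<integral>\<^sup>+\<omega>. T (sample X n \<omega>) \<partial>\<Omega>) \<le> 1" .
qed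

text \<open>Finiteness is essential: \<open>enn2real\<close> sends \<infinity> to 0, so the bound
  would fail for an unbounded set.\<close>

lemma dist_le_diam:
  assumes "x \<in> I" "y \<in> I" "diam I < \<infinity>"
  shows "dist x y \<le> enn2real (diam I)"
proof -
  have "ennreal (dist x y) \<le> diam I"
    unfolding diam_def using assms(1,2) by (meson SUP_upper2 order_refl)
  from enn2real_mono[OF this] assms(3) show ?thesis
    by simp
qed

lemma dist_bigo_diam:
  assumes "\<forall>\<^sub>F n in F. x n \<in> I n" "\<forall>\<^sub>F n in F. y n \<in> I n" "\<forall>\<^sub>F n in F. diam (I n) < \<infinity>"
  shows "(\<lambda>n. dist (x n) (y n)) \<in> O[F](\<lambda>n. enn2real (diam (I n)))"
proof (rule landau_o.big_mono)
  show "\<forall>\<^sub>F n in F. norm (dist (x n) (y n)) \<le> norm (enn2real (diam (I n)))"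
    using assms by eventually_elim (simp add: dist_le_diam)
qed

theorem theorem2p4:
  fixes \<Theta> :: "'p::metric_space set"
    and S :: "'a measure"
    and \<P> :: "'p \<Rightarrow> 'a measure set"
    and \<Omega> :: "'w measure"
    and X :: "nat \<Rightarrow> 'w \<Rightarrow> 'a"
    and Pstar :: "'a measure"
    and \<theta>star :: 'p
    and M :: "nat \<Rightarrow> 'p \<Rightarrow> (nat \<Rightarrow> 'a) \<Rightarrow> ennreal"
    and \<theta>E :: "nat \<Rightarrow> 'w \<Rightarrow> 'p"
    and \<alpha> :: "nat \<Rightarrow> real"
  assumes model: "\<And>\<theta>. \<theta> \<in> \<Theta> \<Longrightarrow> \<P> \<theta> \<subseteq> space (prob_algebra S)"
    and truth: "\<theta>star \<in> \<Theta>" "Pstar \<in> \<P> \<theta>star"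
    and iid: "iid_from \<Omega> S X Pstar"
    and evalue: "\<And>n \<theta>. n \<ge> 1 \<Longrightarrow> \<theta> \<in> \<Theta> \<Longrightarrow> e_value S (\<P> \<theta>) n (M n \<theta>)"
    and ME: "\<And>n \<omega>. n \<ge> 1 \<Longrightarrow> \<omega> \<in> space \<Omega> \<Longrightarrow>
               is_arg_min (\<lambda>\<theta>. M n \<theta> (sample X n \<omega>)) (\<lambda>\<theta>. \<theta> \<in> \<Theta>) (\<theta>E n \<omega>)"
    and \<alpha>: "\<And>n. n \<ge> 1 \<Longrightarrow> 0 < \<alpha> n \<and> \<alpha> n < 1"
    and \<alpha>_sum: "summable (\<lambda>n. \<alpha> (Suc n))"
  shows "almost_sure_for \<Omega> (CI \<Theta> M X \<alpha>) \<theta>star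
    \<and> (AE \<omega> in \<Omega>. \<forall>\<^sub>F n in sequentially. \<theta>star \<in> CI \<Theta> M X \<alpha> n \<omega>)
    \<and> (AE \<omega> in \<Omega>. \<forall>\<^sub>F n in sequentially. \<theta>E n \<omega> \<in> CI \<Theta> M X \<alpha> n \<omega>)
    \<and> (\<forall>r :: nat \<Rightarrow> real. (\<forall>n\<ge>1. r n > 0) \<longrightarrow>
         (AE \<omega> in \<Omega>. ennreal_bigo (\<lambda>n. diam (CI \<Theta> M X \<alpha> n \<omega>)) r \<longrightarrow>
            (\<lambda>n. dist (\<theta>E n \<omega>) \<theta>star) \<in> O(r)) \<and>
         (AE \<omega> in \<Omega>. ennreal_smallo (\<lambda>n. diam (CI \<Theta> M X \<alpha> n \<omega>)) r \<longrightarrow>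
            (\<lambda>n. dist (\<theta>E n \<omega>) \<theta>star) \<in> o(r)))"
proof -
  interpret prob_space \<Omega>
    using iid by (simp add: iid_from_def)
  have star: "AE \<omega> in \<Omega>. \<forall>\<^sub>F n in sequentially. \<theta>star \<in> CI \<Theta> M X \<alpha> n \<omega>"
  proof -
    \<comment> \<open>The shift to \<open>Suc n\<close> avoids index 0, where neither
      \<open>\<alpha>\<close> nor the e-values are constrained.\<close>
    have "AE \<omega> in \<Omega>. \<forall>\<^sub>F n in sequentially.
        M (Suc n) \<theta>star (sample X (Suc n) \<omega>) \<le> ennreal (1 / \<alpha> (Suc n))"
      using e_value_sample[OF iid _ truth(2) evalue[OF _ truth(1)]] \<alpha> \<alpha>_sum
      by (intro AE_eventually_le_inverse_of_nn_integral_le_one) simp_all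
    then show ?thesis
    proof eventually_elim
      case (elim \<omega>)
      then have "\<forall>\<^sub>F n in sequentially. \<theta>star \<in> CI \<Theta> M X \<alpha> (Suc n) \<omega>"
        using truth(1) by (simp add: CI_def)
      then show ?case
        by (rule eventually_sequentially_Suc[THEN iffD1])
    qed
  qed
  have est: "AE \<omega> in \<Omega>. \<forall>\<^sub>F n in sequentially. \<theta>E n \<omega> \<in> CI \<Theta> M X \<alpha> n \<omega>"
    using star AE_space
  proof eventually_elim
    case (elim \<omega>)
    from elim(1) eventually_ge_at_top[of 1] show ?case
    proof eventually_elim
      case (elim n)
      \<comment> \<open>\<open>is_arg_min\<close> only denies a strictly smaller value in \<Theta>;
        as \<open>ennreal\<close> is linearly ordered, the value at the estimator is at most that at
        \<open>\<theta>star\<close>, hence at most 1/\<alpha>_n.\<close>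
      then show ?case
        using ME[OF elim(2) \<open>\<omega> \<in> space \<Omega>\<close>]
        by (auto simp: CI_def is_arg_min_def not_less intro: order_trans)
    qed
  qed
  have "almost_sure_for \<Omega> (CI \<Theta> M X \<alpha>) \<theta>star"
    unfolding almost_sure_for_def using star
  proof eventually_elim
    case (elim \<omega>)
    then obtain N where "\<forall>n\<ge>N. \<theta>star \<in> CI \<Theta> M X \<alpha> n \<omega>"
      by (auto simp: eventually_sequentially)
    then show ?case
      \<comment> \<open>The 2 is there because \<open>almost_sure_for\<close> asks for an index
        above 1.\<close>
      by (intro exI[of _ "max 2 N"]) auto
  qed
  \<comment> \<open>Conditioning becomes an implication that holds pathwise wherever
    \<open>star\<close> and \<open>est\<close> hold, so the exceptional null set does not depend on
    \<open>r\<close>. The finiteness clause of \<open>ennreal_bigo\<close> supplies the last premise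
    of \<open>dist_bigo_diam\<close>.\<close>
  moreover have "AE \<omega> in \<Omega>. ennreal_bigo (\<lambda>n. diam (CI \<Theta> M X \<alpha> n \<omega>)) r \<longrightarrow>
      (\<lambda>n. dist (\<theta>E n \<omega>) \<theta>star) \<in> O(r)" for r
    using star est
    by eventually_elim
      (unfold ennreal_bigo_def, intro impI, elim conjE,
        rule landau_o.big_trans[OF dist_bigo_diam], assumption+)
  moreover have "AE \<omega> in \<Omega>. ennreal_smallo (\<lambda>n. diam (CI \<Theta> M X \<alpha> n \<omega>)) r \<longrightarrow>
      (\<lambda>n. dist (\<theta>E n \<omega>) \<theta>star) \<in> o(r)" for r
    using star est
    by eventually_elim
      (unfold ennreal_smallo_def, intro impI, elim conjE,
        rule landau_o.big_small_trans[OF dist_bigo_diam], assumption+)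
  ultimately show ?thesis
    using star est by blast
qed

end
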